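(* For every positive integer $d$, we have the inequality $$\dim \langle \operatorname{uMPS}(2,2,d) \rangle \leq \begin{cases} \frac{1}{192}(d+6)(d+4)^2(d+2) & \text{for } d \text{ even},\\[1mm] \frac{1}{192}(d+7)(d+5)(d+3)(d+1) & \text{for } d \text{ odd}. \end{cases}$$
   Context: Let $e_0,e_1$ be the standard basis of $\mathbb{C}^2$. $\operatorname{uMPS}(2,2,d)$ is the closure (equivalently Euclidean or Zariski) of the image of the map $$\phi\colon (\mathbb{C}^{2\times 2})^2 \to (\mathbb{C}^2)^{\otimes d},\qquad (A_0,A_1)\mapsto \sum_{i_1,\dots,i_d\in\{0,1\}} \operatorname{Tr}(A_{i_1}\cdots A_{i_d})\, e_{i_1}\otimes\cdots\otimes e_{i_d}.$$ $\langle \operatorname{uMPS}(2,2,d)\rangle$ denotes its linear span, i.e. the smallest complex vector subspace of $(\mathbb{C}^2)^{\otimes d}$ containing it, and $\dim$ is the dimension over $\mathbb{C}$. *)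

theory Defs
  imports "HOL-Analysis.Analysis" "HOL-Library.Function_Algebras"
begin

text \<open>
  A tensor in the \<open>d\<close>-fold tensor power of \<open>\<complex>\<^sup>2\<close> is represented by its coordinates with respect to
  the standard product basis: a function on words over the index set \<open>{0, 1}\<close> (the library type
  \<open>2\<close>) that vanishes on all words whose length is not \<open>d\<close>. As \<open>d\<close> is a term and not a type, all
  these spaces live in the one ambient space \<open>2 list \<Rightarrow> complex\<close>.
\<close>

type_synonym tensor = "2 list \<Rightarrow> complex"

definition tensor_scale :: "complex \<Rightarrow> tensor \<Rightarrow> tensor" where
  "tensor_scale c T = (\<lambda>w. c * T w)"

interpretation tensor: vector_space tensor_scale
  by standard (auto simp: tensor_scale_def fun_eq_iff algebra_simps)

definition tensor_power :: "nat \<Rightarrow> tensor set" where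
  "tensor_power d = {T. \<forall>w. length w \<noteq> d \<longrightarrow> T w = 0}"

definition pure_tensor :: "(complex^2) list \<Rightarrow> tensor" where
  "pure_tensor vs = (\<lambda>w. if length w = length vs then \<Prod>k<length vs. (vs ! k) $ (w ! k) else 0)"

definition std_basis :: "2 \<Rightarrow> complex^2" where
  "std_basis i = axis i 1"

definition word_product :: "(2 \<Rightarrow> complex^2^2) \<Rightarrow> 2 list \<Rightarrow> complex^2^2" where
  "word_product A w = foldr (\<lambda>i M. A i ** M) w (mat 1)"

text \<open>The pair of matrices \<open>(A\<^sub>0, A\<^sub>1)\<close> is the family \<open>A\<close>.\<close>

definition mps_map :: "nat \<Rightarrow> (2 \<Rightarrow> complex^2^2) \<Rightarrow> tensor" where
  "mps_map d A =
    (\<Sum>w | length w = d. tensor_scale (trace (word_product A w)) (pure_tensor (map std_basis w)))"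

text \<open>
  The closure is taken in the product topology of \<open>2 list \<Rightarrow> complex\<close>. It is contained in the closed
  subspace \<open>tensor_power d\<close> (lemma \<open>uMPS_subset_tensor_power\<close> below), which only has the
  coordinates at the finitely many words of length \<open>d\<close>, so it is the Euclidean closure.
\<close>

definition uMPS :: "nat \<Rightarrow> tensor set" where
  "uMPS d = closure (range (mps_map d))"

lemma pure_tensor_std_basis:
  "pure_tensor (map std_basis v) w = (if w = v then 1 else 0)"
  by (auto simp: pure_tensor_def std_basis_def axis_def list_eq_iff_nth_eq)

lemma finite_words: "finite {w :: 2 list. length w = d}"
  using finite_lists_length_eq[of "UNIV :: 2 set" d] by simp

lemma sum_tensor_apply: "(\<Sum>v\<in>V. f v) w = (\<Sum>v\<in>V. f v w)"
  for f :: "'a \<Rightarrow> tensor"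
  by (induction V rule: infinite_finite_induct) auto

lemma mps_map_apply:
  "mps_map d A w = (if length w = d then trace (word_product A w) else 0)"
  by (simp add: mps_map_def sum_tensor_apply tensor_scale_def pure_tensor_std_basis
      finite_words if_distrib cong: if_cong)

lemma closed_tensor_power: "closed (tensor_power d)"
proof -
  have "closed {T :: tensor. T w = 0}" for w
    by (intro closed_Collect_eq continuous_on_const continuous_on_product_coordinates)
  then show ?thesis
    unfolding tensor_power_def
    by (intro closed_Collect_all closed_Collect_imp) auto
qed

lemma uMPS_subset_tensor_power: "uMPS d \<subseteq> tensor_power d"
  unfolding uMPS_def
  by (intro closure_minimal closed_tensor_power) (auto simp: tensor_power_def mps_map_apply)

text \<open>
  The library's \<open>dim\<close> is 0 for a space without finite basis; this does not happen inside
  \<open>tensor_power d\<close>.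
\<close>

lemma tensor_power_eq_span:
  "tensor_power d = tensor.span ((\<lambda>w. pure_tensor (map std_basis w)) ` {w. length w = d})"
    (is "_ = tensor.span ?B")
proof
  show "tensor_power d \<subseteq> tensor.span ?B"
  proof
    fix T assume T: "T \<in> tensor_power d"
    have "T = (\<Sum>w | length w = d. tensor_scale (T w) (pure_tensor (map std_basis w)))"
      using T by (auto simp: fun_eq_iff sum_tensor_apply tensor_scale_def pure_tensor_std_basis
          finite_words if_distrib tensor_power_def cong: if_cong)
    also have "\<dots> \<in> tensor.span ?B"
      by (intro tensor.span_sum tensor.span_scale tensor.span_base) auto
    finally show "T \<in> tensor.span ?B" .
  qed
  have "tensor.subspace (tensor_power d)"
    by (auto simp: tensor.subspace_def tensor_power_def tensor_scale_def)
  moreover have "?B \<subseteq> tensor_power d"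
    by (auto simp: tensor_power_def pure_tensor_std_basis)
  ultimately show "tensor.span ?B \<subseteq> tensor_power d"
    by (rule tensor.span_minimal[rotated])
qed

end

theory Submission
  imports Defs
begin

text \<open>
  By the Cayley-Hamilton theorem and its polarization, every word in two \<open>2 \<times> 2\<close> matrices
  \<open>A\<close>, \<open>B\<close> is a combination of \<open>I\<close>, \<open>A\<close>, \<open>B\<close>, \<open>AB\<close> with coefficients that are polynomials in
  \<open>Tr A\<close>, \<open>Tr B\<close>, \<open>det A\<close>, \<open>det B\<close>, \<open>Tr AB\<close>. Taking traces, every coordinate of the map \<open>\<phi>\<close> is a
  polynomial in these five functions that is homogeneous of degree \<open>d\<close> for the weights
  \<open>1, 1, 2, 2, 2\<close>. Hence the image of \<open>\<phi>\<close> lies in a subspace spanned by one tensor per monomial of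
  weighted degree \<open>d\<close>. This subspace is closed, so it also contains the closure, and the bound is
  the number of these monomials.
\<close>

section \<open>Weighted homogeneous polynomials in the five invariants\<close>

type_synonym matrix_pair = "2 \<Rightarrow> complex^2^2"

definition func_scale :: "complex \<Rightarrow> ('a \<Rightarrow> complex) \<Rightarrow> 'a \<Rightarrow> complex" where
  "func_scale c f = (\<lambda>x. c * f x)"

interpretation func: vector_space func_scale
  by standard (auto simp: func_scale_def fun_eq_iff algebra_simps)

text \<open>Indices in the library type \<open>2\<close> are written \<open>1\<close> and \<open>2\<close>, where \<open>2 = 0\<close>.\<close>

definition trace_monomial :: "nat \<times> nat \<times> nat \<times> nat \<times> nat \<Rightarrow> matrix_pair \<Rightarrow> complex" where
  "trace_monomial = (\<lambda>(a, b, i, j, k) A. trace (A 1) ^ a * trace (A 2) ^ b *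
     det (A 1) ^ i * det (A 2) ^ j * trace (A 1 ** A 2) ^ k)"

definition weight :: "nat \<times> nat \<times> nat \<times> nat \<times> nat \<Rightarrow> nat" where
  "weight = (\<lambda>(a, b, i, j, k). a + b + 2 * (i + j + k))"

text \<open>The degree is an integer so that there are no nonzero polynomials of negative degree.\<close>

definition trace_polys :: "int \<Rightarrow> (matrix_pair \<Rightarrow> complex) set" where
  "trace_polys n = func.span (trace_monomial ` {e. int (weight e) = n})"

lemma trace_polys_zero: "(\<lambda>A. 0) \<in> trace_polys n"
  using func.span_zero unfolding trace_polys_def zero_fun_def .

lemma trace_polys_add:
  "f \<in> trace_polys n \<Longrightarrow> g \<in> trace_polys n \<Longrightarrow> (\<lambda>A. f A + g A) \<in> trace_polys n"
  using func.span_add[of f _ g] unfolding trace_polys_def plus_fun_def by simp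

lemma trace_polys_scale: "f \<in> trace_polys n \<Longrightarrow> (\<lambda>A. c * f A) \<in> trace_polys n"
  using func.span_scale[of f _ c] unfolding trace_polys_def func_scale_def by simp

lemma trace_polys_uminus: "f \<in> trace_polys n \<Longrightarrow> (\<lambda>A. - f A) \<in> trace_polys n"
  using trace_polys_scale[of f n "-1"] by simp

lemma trace_polys_diff:
  assumes "f \<in> trace_polys n" "g \<in> trace_polys n"
  shows "(\<lambda>A. f A - g A) \<in> trace_polys n"
  using trace_polys_add[OF assms(1) trace_polys_uminus[OF assms(2)]] by simp

lemma trace_polys_one: "(\<lambda>A. 1) \<in> trace_polys 0"
proof -
  have "trace_monomial (0, 0, 0, 0, 0) \<in> trace_polys 0"
    unfolding trace_polys_def by (intro func.span_base imageI) (simp add: weight_def)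
  then show ?thesis
    by (simp add: trace_monomial_def)
qed

text \<open>Multiplying by a generator \<open>g\<close> is linear and acts on monomials as an
  exponent shift \<open>s\<close> of weight \<open>k\<close>, so it is enough to look at the
  spanning monomials.\<close>

lemma trace_polys_mult_monomial:
  assumes "\<And>e. (\<lambda>A. g A * trace_monomial e A) = trace_monomial (s e)"
    and "\<And>e. weight (s e) = weight e + k"
    and "f \<in> trace_polys n" "m = n + int k"
  shows "(\<lambda>A. g A * f A) \<in> trace_polys m"
  using assms(3) unfolding trace_polys_def
proof (induction rule: func.span_induct_alt)
  case base
  show ?case
    using trace_polys_zero by (simp add: trace_polys_def)
next
  case (step c x y)
  then obtain e where e: "x = trace_monomial e" "int (weight e) = n"
    by blast
  have "(\<lambda>A. g A * x A) \<in> trace_polys m"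
    unfolding trace_polys_def e(1) assms(1)
    by (intro func.span_base imageI) (simp add: assms e)
  then have "(\<lambda>A. c * (g A * x A) + g A * y A) \<in> trace_polys m"
    using step unfolding trace_polys_def[symmetric]
    by (intro trace_polys_add trace_polys_scale)
  moreover have "(\<lambda>A. g A * (func_scale c x + y) A) = (\<lambda>A. c * (g A * x A) + g A * y A)"
    by (simp add: func_scale_def plus_fun_def distrib_left mult.left_commute)
  ultimately show ?case
    by (simp only: trace_polys_def)
qed

lemma trace_polys_mult_generators:
  assumes "f \<in> trace_polys n"
  shows "m = n + 1 \<Longrightarrow> (\<lambda>A. trace (A 1) * f A) \<in> trace_polys m"
    and "m = n + 1 \<Longrightarrow> (\<lambda>A. trace (A 2) * f A) \<in> trace_polys m"
    and "m = n + 2 \<Longrightarrow> (\<lambda>A. det (A 1) * f A) \<in> trace_polys m"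
    and "m = n + 2 \<Longrightarrow> (\<lambda>A. det (A 2) * f A) \<in> trace_polys m"
    and "m = n + 2 \<Longrightarrow> (\<lambda>A. trace (A 1 ** A 2) * f A) \<in> trace_polys m"
proof -
  note mult = trace_polys_mult_monomial[OF _ _ assms]
  show "m = n + 1 \<Longrightarrow> (\<lambda>A. trace (A 1) * f A) \<in> trace_polys m"
    by (rule mult[where k = 1 and s = "\<lambda>(a, b, i, j, k). (Suc a, b, i, j, k)"])
      (auto simp: trace_monomial_def weight_def)
  show "m = n + 1 \<Longrightarrow> (\<lambda>A. trace (A 2) * f A) \<in> trace_polys m"
    by (rule mult[where k = 1 and s = "\<lambda>(a, b, i, j, k). (a, Suc b, i, j, k)"])
      (auto simp: trace_monomial_def weight_def)
  show "m = n + 2 \<Longrightarrow> (\<lambda>A. det (A 1) * f A) \<in> trace_polys m"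
    by (rule mult[where k = 2 and s = "\<lambda>(a, b, i, j, k). (a, b, Suc i, j, k)"])
      (auto simp: trace_monomial_def weight_def)
  show "m = n + 2 \<Longrightarrow> (\<lambda>A. det (A 2) * f A) \<in> trace_polys m"
    by (rule mult[where k = 2 and s = "\<lambda>(a, b, i, j, k). (a, b, i, Suc j, k)"])
      (auto simp: trace_monomial_def weight_def)
  show "m = n + 2 \<Longrightarrow> (\<lambda>A. trace (A 1 ** A 2) * f A) \<in> trace_polys m"
    by (rule mult[where k = 2 and s = "\<lambda>(a, b, i, j, k). (a, b, i, j, Suc k)"])
      (auto simp: trace_monomial_def weight_def)
qed

section \<open>Reduction of words by Cayley-Hamilton\<close>

definition basis_comb ::
    "complex \<Rightarrow> complex \<Rightarrow> complex \<Rightarrow> complex \<Rightarrow> complex^2^2 \<Rightarrow> complex^2^2 \<Rightarrow> complex^2^2" where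
  "basis_comb p q r s A B =
    (\<chi> i j. p * mat 1 $ i $ j + q * A $ i $ j + r * B $ i $ j + s * (A ** B) $ i $ j)"

text \<open>Cayley-Hamilton, \<open>A^2 = tr(A) A - det(A) I\<close>, rewrites the products
  \<open>A A\<close> and \<open>A (AB)\<close>.\<close>

lemma basis_comb_mult_left:
  "A ** basis_comb p q r s A B =
    basis_comb (- (det A * q)) (p + trace A * q) (- (det A * s)) (r + trace A * s) A B"
  by (simp add: basis_comb_def vec_eq_iff forall_2 matrix_matrix_mult_def sum_2 mat_def
      trace_def det_2 algebra_simps)

text \<open>The polarized identity is
  \<open>BA = -AB + tr(B) A + tr(A) B + (tr(AB) - tr(A) tr(B)) I\<close>. Together with
  Cayley-Hamilton for \<open>B\<close> it gives
  \<open>BAB = tr(AB) B + det(B) A - tr(A) det(B) I\<close>.\<close>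

lemma basis_comb_mult_right:
  "B ** basis_comb p q r s A B =
    basis_comb
      (trace (A ** B) * q - trace A * (trace B * q) - det B * r - trace A * (det B * s))
      (trace B * q + det B * s)
      (p + trace A * q + trace B * r + trace (A ** B) * s)
      (- q) A B"
  by (simp add: basis_comb_def vec_eq_iff forall_2 matrix_matrix_mult_def sum_2 mat_def
      trace_def det_2 algebra_simps)

lemma trace_basis_comb:
  "trace (basis_comb p q r s A B) = 2 * p + trace A * q + trace B * r + trace (A ** B) * s"
  by (simp add: basis_comb_def sum_2 mat_def trace_def algebra_simps)

text \<open>The matrices \<open>I\<close>, \<open>A\<close>, \<open>B\<close>, \<open>AB\<close>
  have degrees 0, 1, 1, 2, and each coefficient supplies the rest of the word length. Prepending a
  letter raises all degrees by one.\<close>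

lemma word_product_basis_comb:
  "\<exists>p q r s. p \<in> trace_polys (int (length w)) \<and> q \<in> trace_polys (int (length w) - 1) \<and>
     r \<in> trace_polys (int (length w) - 1) \<and> s \<in> trace_polys (int (length w) - 2) \<and>
     (\<forall>A. word_product A w = basis_comb (p A) (q A) (r A) (s A) (A 1) (A 2))"
proof (induction w)
  case Nil
  show ?case
    \<comment> \<open>The empty product has coefficients 1, 0, 0, 0; the zero function also lies in
      the negative degrees -1 and -2.\<close>
    by (intro exI[of _ "\<lambda>A. 1"] exI[of _ "\<lambda>A. 0"])
      (auto simp: trace_polys_zero trace_polys_one word_product_def basis_comb_def vec_eq_iff)
next
  case (Cons x w)
  let ?n = "int (length w)"
  from Cons obtain p q r s where
    p: "p \<in> trace_polys ?n" and q: "q \<in> trace_polys (?n - 1)" and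
    r: "r \<in> trace_polys (?n - 1)" and s: "s \<in> trace_polys (?n - 2)" and
    w: "\<And>A. word_product A w = basis_comb (p A) (q A) (r A) (s A) (A 1) (A 2)"
    by blast
  have len: "int (length (x # w)) = ?n + 1" "?n + 1 - 1 = ?n" "?n + 1 - 2 = ?n - 1"
    by auto
  have step: "word_product A (y # w) = A y ** basis_comb (p A) (q A) (r A) (s A) (A 1) (A 2)"
    for A y
    by (simp add: word_product_def w[symmetric])
  note closure = trace_polys_add trace_polys_diff trace_polys_uminus p q r s
    trace_polys_mult_generators[OF p] trace_polys_mult_generators[OF q]
    trace_polys_mult_generators[OF r] trace_polys_mult_generators[OF s]
  consider "x = 1" | "x = 2"
    using exhaust_2 by blast
  then show ?case
  proof cases
    case 1
    show ?thesis
      unfolding 1 step basis_comb_mult_left len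
      apply (rule exI[of _ "\<lambda>A. - (det (A 1) * q A)"])
      apply (rule exI[of _ "\<lambda>A. p A + trace (A 1) * q A"])
      apply (rule exI[of _ "\<lambda>A. - (det (A 1) * s A)"])
      apply (rule exI[of _ "\<lambda>A. r A + trace (A 1) * s A"])
      by (intro conjI allI refl closure) (simp_all add: p q r s)
  next
    case 2
    \<comment> \<open>The new coefficient of \<open>I\<close> contains products of two generators,
      so the inner products are placed in their degree first.\<close>
    have tq: "(\<lambda>A. trace (A 2) * q A) \<in> trace_polys ?n"
      and ds: "(\<lambda>A. det (A 2) * s A) \<in> trace_polys ?n"
      by (intro closure; simp)+
    show ?thesis
      unfolding 2 step basis_comb_mult_right len
      apply (rule exI[of _ "\<lambda>A. trace (A 1 ** A 2) * q A - trace (A 1) * (trace (A 2) * q A)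
        - det (A 2) * r A - trace (A 1) * (det (A 2) * s A)"])
      apply (rule exI[of _ "\<lambda>A. trace (A 2) * q A + det (A 2) * s A"])
      apply (rule exI[of _ "\<lambda>A. p A + trace (A 1) * q A + trace (A 2) * r A
        + trace (A 1 ** A 2) * s A"])
      apply (rule exI[of _ "\<lambda>A. - q A"])
      by (intro conjI allI refl closure tq ds trace_polys_mult_generators[OF tq]
          trace_polys_mult_generators[OF ds]) (simp_all add: p q r s)
  qed
qed

lemma trace_word_product_in_trace_polys:
  "(\<lambda>A. trace (word_product A w)) \<in> trace_polys (int (length w))"
proof -
  let ?n = "int (length w)"
  from word_product_basis_comb[of w] obtain p q r s where
    p: "p \<in> trace_polys ?n" and q: "q \<in> trace_polys (?n - 1)" and
    r: "r \<in> trace_polys (?n - 1)" and s: "s \<in> trace_polys (?n - 2)" and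
    w: "\<And>A. word_product A w = basis_comb (p A) (q A) (r A) (s A) (A 1) (A 2)"
    by blast
  show ?thesis
    unfolding w trace_basis_comb
    by (intro trace_polys_add trace_polys_scale p trace_polys_mult_generators(1)[OF q]
        trace_polys_mult_generators(2)[OF r] trace_polys_mult_generators(5)[OF s]) auto
qed

section \<open>Counting the monomials of weight \<open>d\<close>\<close>

text \<open>Group by \<open>n = i + j + k\<close>. Given \<open>n\<close> and \<open>i\<close> there
  are \<open>n - i + 1\<close> choices of \<open>j\<close>, and \<open>a\<close> ranges over
  \<open>d - 2 * n + 1\<close> values; \<open>h\<close> recovers \<open>b\<close> and
  \<open>k\<close>.\<close>

lemma card_exponents:
  "finite {e. weight e = d}" (is "finite ?E")
  "card {e. weight e = d} \<le> (\<Sum>n\<le>d div 2. (\<Sum>i\<le>n. n - i + 1) * (d - 2 * n + 1))"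
proof -
  define S where "S = (SIGMA n:{..d div 2}. (SIGMA i:{..n}. {..n - i}) \<times> {..d - 2 * n})"
  define h where "h = (\<lambda>(n, (i, j), a). (a, d - 2 * n - a, i, j, n - i - j :: nat))"
  have fin: "finite S"
    by (auto simp: S_def)
  have "?E \<subseteq> h ` S"
  proof
    fix e assume "e \<in> ?E"
    then obtain a b i j k where e: "e = (a, b, i, j, k)" "d = a + b + 2 * (i + j + k)"
      by (cases e) (auto simp: weight_def)
    then have "e = h (i + j + k, (i, j), a)" "(i + j + k, (i, j), a) \<in> S"
      by (auto simp: h_def S_def)
    then show "e \<in> h ` S"
      by blast
  qed
  then show "finite ?E" "card ?E \<le> (\<Sum>n\<le>d div 2. (\<Sum>i\<le>n. n - i + 1) * (d - 2 * n + 1))"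
    using fin surj_card_le[OF fin, of ?E h] finite_subset[of ?E "h ` S"]
    by (auto simp: S_def card_cartesian_product)
qed

lemma sum_diff_plus_one: "real (\<Sum>i\<le>n. n - i + 1) = (real n + 1) * (real n + 2) / 2"
proof -
  have "(\<Sum>i\<le>n. n - i + 1) = (\<Sum>i\<le>n. i + 1)"
    by (rule sum.reindex_bij_witness[of _ "\<lambda>i. n - i" "\<lambda>i. n - i"]) auto
  also have "real \<dots> = (real n + 1) * (real n + 2) / 2"
    by (induction n) (auto simp: field_simps)
  finally show ?thesis .
qed

lemma sum_exponents_closed_form:
  "(\<Sum>n\<le>m. (real n + 1) * (real n + 2) / 2 * (c - 2 * real n)) =
     (real m + 1) * (real m + 2) * (real m + 3) * (2 * c - 3 * real m) / 12"
  by (induction m) (auto simp: field_simps)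

lemma card_exponents_le:
  "real (card {e. weight e = d}) \<le>
    (if even d
     then 1 / 192 * (real d + 6) * (real d + 4)^2 * (real d + 2)
     else 1 / 192 * (real d + 7) * (real d + 5) * (real d + 3) * (real d + 1))"
proof -
  define m where "m = d div 2"
  have "real (card {e. weight e = d}) \<le>
      real (\<Sum>n\<le>m. (\<Sum>i\<le>n. n - i + 1) * (d - 2 * n + 1))"
    using card_exponents(2) m_def of_nat_le_iff by blast
  also have "\<dots> = (\<Sum>n\<le>m. real (\<Sum>i\<le>n. n - i + 1) * real (d - 2 * n + 1))"
    by (simp only: of_nat_sum of_nat_mult)
  \<comment> \<open>Since \<open>n \<le> d div 2\<close>, the natural subtraction does not
    truncate.\<close>
  also have "\<dots> = (\<Sum>n\<le>m. (real n + 1) * (real n + 2) / 2 * ((real d + 1) - 2 * real n))"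
    unfolding sum_diff_plus_one by (intro sum.cong) (auto simp: m_def of_nat_diff)
  also have "\<dots> =
      (real m + 1) * (real m + 2) * (real m + 3) * (2 * (real d + 1) - 3 * real m) / 12"
    by (rule sum_exponents_closed_form)
  also have "\<dots> = (if even d
     then 1 / 192 * (real d + 6) * (real d + 4)^2 * (real d + 2)
     else 1 / 192 * (real d + 7) * (real d + 5) * (real d + 3) * (real d + 1))"
  \<comment> \<open>The last factor is \<open>m + 2\<close> for even \<open>d\<close> and
    \<open>m + 4\<close> for odd \<open>d\<close>. Doubling all four factors turns the denominator
    12 into 192.\<close>
  proof (cases "even d")
    case True
    then have "real d = 2 * real m"
      by (auto simp: m_def)
    with True show ?thesis
      by (simp add: field_simps power2_eq_square)
  next
    case False
    then have "real d = 2 * real m + 1"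
      by (auto simp: m_def elim!: oddE)
    with False show ?thesis
      by (simp add: field_simps)
  qed
  finally show ?thesis .
qed

section \<open>From the image to its closure\<close>

text \<open>
  A tensor outside of the span is separated from it by a linear functional. On \<open>tensor_power d\<close>
  every functional is a finite combination of coordinates, hence continuous.
\<close>

lemma closed_span_tensor_power:
  assumes "W \<subseteq> tensor_power d"
  shows "closed (tensor.span W)"
proof -
  interpret pair: vector_space_pair tensor_scale "(*) :: complex \<Rightarrow> complex \<Rightarrow> complex"
    by standard (auto simp: algebra_simps)
  let ?V = "tensor.span W"
  let ?e = "\<lambda>w. pure_tensor (map std_basis w)"
  have subspace: "tensor.subspace (tensor_power d)"
    by (simp add: tensor_power_eq_span)
  have sub: "?V \<subseteq> tensor_power d"
    by (rule tensor.span_minimal[OF assms subspace])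
  \<comment> \<open>Separating each outside point by a closed set exhibits \<open>?V\<close> as an
    intersection of closed sets. Outside \<open>tensor_power d\<close>, that space itself
    separates.\<close>
  have "\<exists>C. closed C \<and> ?V \<subseteq> C \<and> T \<notin> C" if T: "T \<notin> ?V" for T
  proof (cases "T \<in> tensor_power d")
    case False
    then show ?thesis
      using sub closed_tensor_power by blast
  next
    case True
    obtain B where B: "B \<subseteq> ?V" "tensor.independent B" "?V \<subseteq> tensor.span B"
      by (rule tensor.basis_exists)
    then have span: "tensor.span B = ?V"
      by (intro subset_antisym tensor.span_minimal tensor.subspace_span B)
    have ind: "tensor.independent (insert T B)"
      using T B(2) span by (simp add: tensor.independent_insert)
    from pair.linear_independent_extend[OF ind, of "\<lambda>x. if x = T then 1 else 0"]
    obtain g where g: "Vector_Spaces.linear tensor_scale (*) g"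
      "\<forall>x\<in>insert T B. g x = (if x = T then 1 else 0)"
      by blast
    have B0: "g x = 0" if "x \<in> B" for x
      using that g(2) T B(1) by auto
    have V0: "g x = 0" if "x \<in> ?V" for x
      using pair.linear_eq_0_on_span[OF g(1) B0] that span by blast
    \<comment> \<open>The extension \<open>g\<close> need not be continuous on the ambient space;
      \<open>h\<close> is, being a finite sum over coordinates, and it agrees with \<open>g\<close>
      on \<open>tensor_power d\<close>.\<close>
    define h where "h = (\<lambda>X :: tensor. \<Sum>w | length w = d. X w * g (?e w))"
    have gh: "g X = h X" if "X \<in> tensor_power d" for X
    proof -
      have "X = (\<Sum>w | length w = d. tensor_scale (X w) (?e w))"
        using that by (auto simp: fun_eq_iff sum_tensor_apply tensor_scale_def
            pure_tensor_std_basis finite_words if_distrib tensor_power_def cong: if_cong)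
      then have "g X = g (\<Sum>w | length w = d. tensor_scale (X w) (?e w))"
        by simp
      also have "\<dots> = h X"
        by (simp add: h_def pair.linear_sum[OF g(1)] pair.linear_scale[OF g(1)])
      finally show ?thesis .
    qed
    have "closed {X. h X = 0}"
      unfolding h_def
      by (intro closed_Collect_eq continuous_on_const continuous_on_sum continuous_on_mult
          continuous_on_product_coordinates)
    moreover have "?V \<subseteq> {X. h X = 0}"
      using V0 by (metis (mono_tags, lifting) gh mem_Collect_eq sub subset_eq)
    moreover have "T \<notin> {X. h X = 0}"
      using gh[OF True] g(2) by simp
    ultimately show ?thesis
      by blast
  qed
  then have "?V = \<Inter>{C. closed C \<and> ?V \<subseteq> C}"
    by blast
  then show ?thesis
    by (metis (no_types, lifting) closed_Inter mem_Collect_eq)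
qed

text \<open>Each coordinate of the map is a combination of monomials. Collecting by monomial
  \<open>v\<close> instead of by word \<open>w\<close> writes the image point as a sum of fixed
  tensors \<open>C v\<close>, weighted by the values \<open>v A\<close>.\<close>

lemma mps_map_in_span:
  obtains W where "finite W" "card W \<le> card {e. weight e = d}" "W \<subseteq> tensor_power d"
    "range (mps_map d) \<subseteq> tensor.span W"
proof -
  let ?B = "trace_monomial ` {e. weight e = d}"
  have fin: "finite ?B"
    using card_exponents(1) by simp
  have "\<forall>w\<in>{w. length w = d}. \<exists>u.
      (\<lambda>A. trace (word_product A w)) = (\<Sum>v\<in>?B. func_scale (u v) v)"
  proof
    fix w :: "2 list" assume "w \<in> {w. length w = d}"
    then have "(\<lambda>A. trace (word_product A w)) \<in> func.span ?B"
      using trace_word_product_in_trace_polys[of w] by (simp add: trace_polys_def)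
    then show "\<exists>u. (\<lambda>A. trace (word_product A w)) = (\<Sum>v\<in>?B. func_scale (u v) v)"
      unfolding func.span_finite[OF fin] by blast
  qed
  from bchoice[OF this] obtain u where
    u: "\<And>w. length w = d \<Longrightarrow>
      (\<lambda>A. trace (word_product A w)) = (\<Sum>v\<in>?B. func_scale (u w v) v)"
    by blast
  have apply_sum: "(\<Sum>v\<in>?B. f v) A = (\<Sum>v\<in>?B. f v A)"
    for f :: "(matrix_pair \<Rightarrow> complex) \<Rightarrow> matrix_pair \<Rightarrow> complex" and A
    using fin by (induction rule: finite_induct) auto
  define C where "C = (\<lambda>v w. if length w = d then u w v else 0)"
  have "mps_map d A = (\<Sum>v\<in>?B. tensor_scale (v A) (C v))" for A
  proof
    fix w
    show "mps_map d A w = (\<Sum>v\<in>?B. tensor_scale (v A) (C v)) w"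
      using fun_cong[OF u, of w A]
      by (auto simp: mps_map_apply sum_tensor_apply tensor_scale_def C_def apply_sum
          func_scale_def mult.commute)
  qed
  moreover have "(\<Sum>v\<in>?B. tensor_scale (v A) (C v)) \<in> tensor.span (C ` ?B)" for A
    by (intro tensor.span_sum tensor.span_scale tensor.span_base imageI)
  ultimately have "range (mps_map d) \<subseteq> tensor.span (C ` ?B)"
    by auto
  moreover have "card (C ` ?B) \<le> card {e. weight e = d}"
    using card_image_le[OF fin, of C] card_image_le[OF card_exponents(1), of trace_monomial d]
    by linarith
  moreover have "C ` ?B \<subseteq> tensor_power d"
    by (auto simp: C_def tensor_power_def)
  ultimately show thesis
    using that[of "C ` ?B"] fin by blast
qed

theorem theorem4p8:
  fixes d :: nat
  assumes "d \<ge> 1"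
  shows "real (tensor.dim (tensor.span (uMPS d))) \<le>
    (if even d
     then 1 / 192 * (real d + 6) * (real d + 4)^2 * (real d + 2)
     else 1 / 192 * (real d + 7) * (real d + 5) * (real d + 3) * (real d + 1))"
proof -
  obtain W where W: "finite W" "card W \<le> card {e. weight e = d}" "W \<subseteq> tensor_power d"
    "range (mps_map d) \<subseteq> tensor.span W"
    by (rule mps_map_in_span)
  have "uMPS d \<subseteq> tensor.span W"
    unfolding uMPS_def using W by (intro closure_minimal closed_span_tensor_power)
  then have "tensor.span (uMPS d) \<subseteq> tensor.span W"
    by (simp add: tensor.span_minimal)
  then have "tensor.dim (tensor.span (uMPS d)) \<le> card W"
    using W(1) by (rule tensor.dim_le_card)
  then have "real (tensor.dim (tensor.span (uMPS d))) \<le> real (card {e. weight e = d})"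
    using W(2) by simp
  also note card_exponents_le
  finally show ?thesis .
qed

end
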